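(* Let $n$ be an even positive integer and $F$ be a finite field with characteristic coprime to $n$. Let $C_{g,g'}$ be the quasi-cyclic code of index $1\frac12$ generated by $\big(g(X),g'(X)\big)$, where $g(X)=\sum_{j=0}^{n-1}g_jX^j$ and $g'(X)=\sum_{j'=0}^{\frac n2-1}g'_{j'}X^{j'}$ are polynomials over $F$. Let $$r=n-\deg\Big(\gcd\big(g(X),X^{\frac n2}+1\big)\cdot\gcd\big(g(X),g'(X),X^{\frac n2}-1\big)\Big).$$ Then $\dim C_{g,g'}=r$, and the first $r$ rows of the double circulant matrix $M(g,g')_{n\times(n+\frac n2)}$ associated with $g(X)$ and $g'(X)$ form a generator matrix of $C_{g,g'}$.
   Context: The code $C_{g,g'}$ is the following submodule of the $F[X]/\langle X^n-1\rangle$-module $F[X]/\langle X^n-1\rangle\times F[X]/\langle X^{n/2}-1\rangle$: $$C_{g,g'}=\big\{\big(f(X)g(X)\bmod (X^n-1),\; f(X)g'(X)\bmod (X^{n/2}-1)\big)\;\big|\; f(X)\in F[X]\big\}.$$ An element $\big(a(X),a'(X)\big)$ with $a(X)=\sum_{j=0}^{n-1}a_jX^j$, $a'(X)=\sum_{j=0}^{n/2-1}a'_jX^j$ is identified with the word $(a_0,\dots,a_{n-1},a'_0,\dots,a'_{n/2-1})\in F^{n+n/2}$, so $C_{g,g'}$ is viewed as a linear subspace of $F^{n+n/2}$. A generator matrix of a linear code (subspace of $F^N$) is a matrix whose rows form a basis of the code. For a polynomial $g(X)=\sum_{j=0}^{n-1}g_jX^j$ of degree less than $n$, the generalized circulant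 matrix $M(g)_{m\times n}$ is the $m\times n$ matrix over $F$ whose $(i,j)$ entry ($0\le i<m$, $0\le j<n$) is $g_{(j-i)\bmod n}$; i.e. each row is the circular right shift of the previous one, the first row being $(g_0,\dots,g_{n-1})$. The double circulant matrix associated with $g(X)$ (with $\deg g<n$) and $g'(X)$ (with $\deg g'<n'$) is the side-by-side concatenation $M(g,g')_{m\times(n+n')}=\big(M(g)_{m\times n}\,\big|\,M(g')_{m\times n'}\big)$; here $n'=n/2$ and $m=n$. The $\gcd$ of polynomials is the greatest common divisor in $F[X]$ (zero polynomials being divisible by everything, so e.g. $\gcd(0,f)=f$). *)

theory Defs
  imports "Jordan_Normal_Form.VS_Connect" "HOL-Computational_Algebra.Computational_Algebra"
begin

text \<open>
  Words of length \<open>N\<close> over \<open>F\<close> are elements of \<open>carrier_vec N\<close>. Wherever polynomial gcds occur, the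
  field has sort \<^class>\<open>field_gcd\<close>: this adds no restriction, since every field can be equipped
  with the required operations, and it makes \<open>gcd\<close> on \<open>F[X]\<close> the usual monic gcd
  (with \<open>gcd 0 0 = 0\<close>).
\<close>

text \<open>
  Residues modulo \<open>X^n - 1\<close> and \<open>X^(n/2) - 1\<close> are represented by their remainders.
\<close>

definition qc_pairs :: "nat \<Rightarrow> 'a::field poly \<Rightarrow> 'a poly \<Rightarrow> ('a poly \<times> 'a poly) set" where
  "qc_pairs n g g' =
     {((f * g) mod (monom 1 n - 1), (f * g') mod (monom 1 (n div 2) - 1)) | f. True}"

definition word_of :: "nat \<Rightarrow> 'a::field poly \<times> 'a poly \<Rightarrow> 'a vec" where
  "word_of n = (\<lambda>(a, a'). vec n (coeff a) @\<^sub>v vec (n div 2) (coeff a'))"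

definition qc_code :: "nat \<Rightarrow> 'a::field poly \<Rightarrow> 'a poly \<Rightarrow> 'a vec set" where
  "qc_code n g g' = word_of n ` qc_pairs n g g'"

text \<open>The column index \<open>j - i\<close> is reduced modulo \<open>n\<close> over the integers, where it may be negative.\<close>

definition gen_circulant :: "nat \<Rightarrow> nat \<Rightarrow> 'a::field poly \<Rightarrow> 'a mat" where
  "gen_circulant m n g = mat m n (\<lambda>(i, j). coeff g (nat ((int j - int i) mod int n)))"

definition double_circulant ::
  "nat \<Rightarrow> nat \<Rightarrow> nat \<Rightarrow> 'a::field poly \<Rightarrow> 'a poly \<Rightarrow> 'a mat" where
  "double_circulant m n n' g g' =
     mat m (n + n') (\<lambda>(i, j). if j < n then gen_circulant m n g $$ (i, j)
                              else gen_circulant m n' g' $$ (i, j - n))"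

definition first_rows :: "nat \<Rightarrow> 'a mat \<Rightarrow> 'a mat" where
  "first_rows r A = mat_of_rows (dim_col A) (take r (rows A))"

abbreviation code_space :: "nat \<Rightarrow> 'a::field vec set \<Rightarrow> ('a, 'a vec) module" where
  "code_space N C \<equiv> (module_vec TYPE('a) N)\<lparr>carrier := C\<rparr>"

definition code_dim :: "nat \<Rightarrow> 'a::field vec set \<Rightarrow> nat" where
  "code_dim N C = vectorspace.dim class_ring (code_space N C)"

text \<open>
  A basis in the library is a set of vectors, so pairwise distinctness of the rows has to be
  required separately.
\<close>

definition is_generator_matrix :: "nat \<Rightarrow> 'a::field mat \<Rightarrow> 'a vec set \<Rightarrow> bool" where
  "is_generator_matrix N G C \<longleftrightarrow>
     dim_col G = N \<and> distinct (rows G) \<and>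
     vectorspace.basis class_ring (code_space N C) (set (rows G))"

text \<open>
  The dimension and basis notions above are meaningful only for subspaces of \<open>F^N\<close>.
\<close>

lemma word_of_add:
  "word_of n (a, a') + word_of n (b, b') = word_of n (a + b, a' + b')"
  by (auto simp: word_of_def)

lemma word_of_smult:
  "c \<cdot>\<^sub>v word_of n (a, a') = word_of n (smult c a, smult c a')"
  by (auto simp: word_of_def)

lemma qc_code_subspace:
  fixes g g' :: "'a::field poly"
  shows "VectorSpace.subspace class_ring (qc_code n g g') (module_vec TYPE('a) (n + n div 2))"
proof -
  interpret vec_space "TYPE('a)" "n + n div 2" .
  define w where "w = (\<lambda>f. word_of n ((f * g) mod (monom 1 n - 1), (f * g') mod (monom 1 (n div 2) - 1)))"
  have C: "qc_code n g g' = range w"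
    by (auto simp: w_def qc_code_def qc_pairs_def)
  have z: "0\<^sub>v (n + n div 2) = w 0"
    by (auto simp: w_def word_of_def)
  have a: "w f + w h = w (f + h)" for f h
    by (simp add: w_def word_of_add poly_mod_add_left distrib_right)
  have s: "c \<cdot>\<^sub>v w f = w (smult c f)" for c f
    by (simp add: w_def word_of_smult mod_smult_left)
  have "submodule class_ring (qc_code n g g') V"
  proof (unfold_locales, goal_cases)
    case 1 show ?case by (auto simp: C w_def word_of_def)
  next
    case 3 show ?case unfolding C module_vec_simps by (simp add: z)
  next
    case (2 u v)
    then obtain f h where "u = w f" "v = w h" unfolding C by blast
    then show ?case unfolding C module_vec_simps by (simp add: a)
  next
    case (4 c v)
    then obtain f where "v = w f" unfolding C by blast
    then show ?case unfolding C module_vec_simps by (simp add: s)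
  qed
  then show ?thesis using vec_vs by (simp add: VectorSpace.subspace_def)
qed

end

theory Submission
  imports Defs
begin

text \<open>
  The code is the image of the linear map \<open>f \<mapsto> (f g, f g')\<close> from \<open>F[X]\<close>, reduced modulo
  \<open>X^n - 1\<close> and \<open>X^(n/2) - 1\<close>; below this map is called \<open>encode\<close>. Its kernel is an ideal, hence
  generated by one polynomial \<open>h\<close>. As soon as \<open>h \<noteq> 0\<close>, division with remainder by \<open>h\<close> shows
  that the images of \<open>1, X, \<dots>, X^(deg h - 1)\<close> are distinct and form a basis of the image
  (\<open>monomial_images_basis\<close>). Multiplication by \<open>X\<close> modulo \<open>X^n - 1\<close> is a cyclic shift of the
  coefficients, so the image of \<open>X^i\<close> is row \<open>i\<close> of the double circulant matrix
  (\<open>row_double_circulant_eq_encode\<close>). It remains to compute \<open>deg h\<close>.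

  Write \<open>X^n - 1 = t s\<close> with \<open>t = X^(n/2) - 1\<close> and \<open>s = X^(n/2) + 1\<close>. The characteristic is
  coprime to the even number \<open>n\<close>, hence not \<open>2\<close>, so \<open>s - t = 2\<close> is a unit and \<open>s\<close>, \<open>t\<close> are coprime. Thus \<open>f\<close> lies
  in the kernel iff \<open>s\<close> divides \<open>f g\<close> and \<open>t\<close> divides both \<open>f g\<close> and \<open>f g'\<close>, that is, iff \<open>f\<close>
  is divisible by \<open>s / gcd(g, s)\<close> and by \<open>t / gcd(g, g', t)\<close>
  (\<open>dvd_mult_mult_iff_cofactor_dvd\<close>). These are coprime, so \<open>h\<close> is their product, whose degree is
  \<open>n\<close> minus the degree of the product of the two gcds.
\<close>

section \<open>Divisibility of products and gcd cofactors\<close>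

lemma dvd_mult_iff_cofactor_dvd:
  fixes q g :: "'a::semiring_gcd"
  assumes "q \<noteq> 0"
  shows "q dvd f * g \<longleftrightarrow> q div gcd g q dvd f"
proof -
  define d where "d = gcd g q"
  have "d \<noteq> 0" using assms by (simp add: d_def)
  then obtain g1 q1 where g1: "g = g1 * d" and q1: "q = q1 * d" and cop: "coprime g1 q1"
    using gcd_coprime_exists[of g q] unfolding d_def by blast
  have "q dvd f * g \<longleftrightarrow> q1 * d dvd (f * g1) * d"
    by (simp only: g1 q1 mult.assoc)
  also have "\<dots> \<longleftrightarrow> q1 dvd f"
    using \<open>d \<noteq> 0\<close> cop by (simp add: coprime_commute coprime_dvd_mult_left_iff)
  also have "q1 = q div gcd g q"
    unfolding d_def[symmetric] using q1 \<open>d \<noteq> 0\<close> by simp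
  finally show ?thesis .
qed

text \<open>
  Under the Chinese remainder splitting, the factor \<open>s\<close> constrains only \<open>f * g\<close>, while \<open>t\<close>
  constrains both products; the two constraints on \<open>t\<close> merge into one on \<open>f * gcd g g'\<close>.
\<close>

lemma dvd_mult_mult_iff_cofactor_dvd:
  fixes s t g g' :: "'a::semiring_gcd"
  assumes "coprime t s" and "t \<noteq> 0" and "s \<noteq> 0"
  shows "t * s dvd f * g \<and> t dvd f * g' \<longleftrightarrow> (s div gcd g s) * (t div gcd (gcd g g') t) dvd f"
proof -
  have "s div gcd g s dvd s" and "t div gcd (gcd g g') t dvd t"
    by (rule dvdI[where k = "gcd g s"], simp) (rule dvdI[where k = "gcd (gcd g g') t"], simp)
  then have cop: "coprime (s div gcd g s) (t div gcd (gcd g g') t)"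
    using assms(1) by (meson coprime_commute coprime_divisors)
  have "t * s dvd f * g \<and> t dvd f * g' \<longleftrightarrow> s dvd f * g \<and> t dvd f * g \<and> t dvd f * g'"
    using assms(1) by (metis divides_mult dvd_mult_left dvd_mult_right)
  also have "\<dots> \<longleftrightarrow> s dvd f * g \<and> t dvd f * gcd g g'"
    using gcd_greatest_iff[of t "f * g" "f * g'"] by (simp add: gcd_mult_left)
  also have "\<dots> \<longleftrightarrow> (s div gcd g s) * (t div gcd (gcd g g') t) dvd f"
    using cop dvd_mult_iff_cofactor_dvd[OF assms(2)] dvd_mult_iff_cofactor_dvd[OF assms(3)]
    by (metis divides_mult dvd_mult_left dvd_mult_right)
  finally show ?thesis .
qed

section \<open>Cyclic shifts as multiplication by powers of X\<close>

lemma degree_monom_diff_1: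
  fixes n :: nat
  assumes "n > 0"
  shows "degree (monom 1 n - 1 :: 'a::field poly) = n"
  using assms degree_add_eq_left[of "-1 :: 'a poly" "monom 1 n"] by (simp add: degree_monom_eq)

lemma coeff_X_mult_mod_cyclic:
  fixes p :: "'a::field poly"
  assumes "n > 0" and "degree p < n" and "j < n"
  shows "coeff ((monom 1 1 * p) mod (monom 1 n - 1)) j = coeff p (nat ((int j - 1) mod int n))"
proof -
  \<comment> \<open>The only overflow of \<open>X * p\<close> is the term of degree \<open>n\<close>, which wraps around to degree 0.\<close>
  define c where "c = coeff p (n - 1)"
  define s where "s = pCons 0 p - smult c (monom 1 n - 1)"
  have "coeff s i = 0" if "i \<ge> n" for i
    using that assms(1,2) by (cases "i = n") (auto simp: s_def c_def coeff_pCons' intro!: coeff_eq_0)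
  then have "degree s < n"
    using assms(1) by (metis degree_0 leading_coeff_0_iff not_le)
  then have "(smult c (monom 1 n - 1) + s) mod (monom 1 n - 1) = s"
    using degree_monom_diff_1[OF assms(1), where 'a='a]
    by (simp add: poly_mod_add_left mod_smult_left mod_poly_less)
  moreover have "monom 1 1 * p = smult c (monom 1 n - 1) + s"
    by (simp add: s_def monom_altdef)
  ultimately have "coeff ((monom 1 1 * p) mod (monom 1 n - 1)) j = coeff s j" by simp
  also have "\<dots> = coeff p (nat ((int j - 1) mod int n))"
  proof (cases j)
    case 0
    have "(-1) mod int n = int n - 1" using assms(1) by (simp add: zmod_minus1)
    then show ?thesis using 0 assms(1) by (simp add: s_def c_def nat_diff_distrib)
  next
    case (Suc i)
    then show ?thesis using assms(3) by (simp add: s_def)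
  qed
  finally show ?thesis .
qed

text \<open>
  Each multiplication by \<open>X\<close> shifts the coefficients by one place, so the claim follows by
  induction on \<open>i\<close>. The degree bound on \<open>g\<close> makes \<open>g\<close> its own remainder in the case \<open>i = 0\<close>.
\<close>

lemma coeff_shift_mod_cyclic:
  fixes g :: "'a::field poly"
  assumes "n > 0" and "degree g < n" and "j < n"
  shows "coeff ((monom 1 i * g) mod (monom 1 n - 1)) j = coeff g (nat ((int j - int i) mod int n))"
  using assms(3)
proof (induction i arbitrary: j)
  case 0
  then show ?case
    using assms degree_monom_diff_1[OF assms(1), where 'a='a] by (simp add: mod_poly_less)
next
  case (Suc i)
  let ?P = "monom 1 n - 1 :: 'a poly"
  let ?q = "(monom 1 i * g) mod ?P"
  have deg: "degree ?q < n"
    using degree_mod_less[of ?P "monom 1 i * g"] degree_monom_diff_1[OF assms(1), where 'a='a] assms(1)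
    by force
  have "(monom 1 (Suc i) * g) mod ?P = (monom 1 1 * ?q) mod ?P"
    by (simp add: mod_mult_right_eq mult_monom mult.assoc[symmetric])
  then have "coeff ((monom 1 (Suc i) * g) mod ?P) j = coeff ?q (nat ((int j - 1) mod int n))"
    using coeff_X_mult_mod_cyclic[OF assms(1) deg Suc.prems] by simp
  also have "\<dots> = coeff g (nat (((int j - 1) mod int n - int i) mod int n))"
    using Suc.IH[of "nat ((int j - 1) mod int n)"] assms(1)
    by (simp add: nat_less_iff)
  also have "((int j - 1) mod int n - int i) mod int n = (int j - int (Suc i)) mod int n"
    by (simp add: mod_diff_left_eq algebra_simps)
  finally show ?case .
qed

section \<open>Images of linear maps whose kernel is a principal ideal\<close>

text \<open>
  The range of \<open>w\<close> is isomorphic to \<open>F[X]\<close> modulo \<open>p\<close>, in which the monomials of degree less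
  than \<open>degree p\<close> form a basis: modulo \<open>p\<close> every polynomial equals its remainder, and a nonzero
  polynomial of smaller degree than \<open>p\<close> is not a multiple of \<open>p\<close>. The case \<open>degree p = 0\<close> is the
  zero space with the empty basis.
\<close>

lemma monomial_images_basis:
  fixes w :: "'a::field poly \<Rightarrow> 'a vec" and N :: nat
  assumes subsp: "VectorSpace.subspace class_ring (range w) (module_vec TYPE('a) N)"
    and add: "\<And>f h. w (f + h) = w f + w h"
    and smult: "\<And>c f. w (smult c f) = c \<cdot>\<^sub>v w f"
    and ker: "\<And>f. w f = 0\<^sub>v N \<longleftrightarrow> p dvd f"
    and "p \<noteq> 0"
  shows "inj_on (\<lambda>i. w (monom 1 i)) {..<degree p}"
    and "vectorspace.basis class_ring (code_space N (range w)) ((\<lambda>i. w (monom 1 i)) ` {..<degree p})"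
    and "code_dim N (range w) = degree p"
proof -
  let ?I = "{..<degree p}"
  define b where "b = (\<lambda>i. w (monom 1 i))"
  interpret V: vectorspace class_ring "module_vec TYPE('a) N" by (rule vec_vs)
  interpret C: vectorspace class_ring "code_space N (range w)"
    by (rule V.subspace_is_vs[OF subsp])
  have carr: "w f \<in> carrier_vec N" for f
    using submodule.subset[of class_ring "range w" "module_vec TYPE('a) N"] subsp
    unfolding VectorSpace.subspace_def by (auto simp: module_vec_simps)
  have diff0: "w (f - h) = 0\<^sub>v N" if "w f = w h" for f h
    using add[of f "smult (-1) h"] smult[of "-1" h] that carr[of h] by auto
  have low: "f = 0" if "w f = 0\<^sub>v N" "\<And>i. i \<ge> degree p \<Longrightarrow> coeff f i = 0" for f
  proof (rule ccontr)
    assume "f \<noteq> 0"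
    moreover have "p dvd f" using ker that(1) by blast
    ultimately show False
      using that(2)[of "degree f"] dvd_imp_degree_le[of p f] by simp
  qed
  have coeffs: "coeff (\<Sum>i\<in>?I. monom (c i) i) j = (if j < degree p then c j else 0)" for c j
    by (simp add: coeff_sum)
  have inj: "inj_on b ?I"
  proof (rule inj_onI)
    fix i j assume ij: "i \<in> ?I" "j \<in> ?I" "b i = b j"
    have "monom 1 i - monom 1 j = (0 :: 'a poly)"
      using ij by (intro low diff0) (auto simp: b_def)
    then show "i = j" by (simp add: monom_eq_iff')
  qed
  have lincomb: "C.lincomb a (b ` J) = w (\<Sum>i\<in>J. monom (a (b i)) i)" if "J \<subseteq> ?I" for a J
  proof -
    have "finite J" using that finite_subset by blast
    then show ?thesis using that
    proof (induction J)
      case empty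
      show ?case using ker[of 0] by (simp add: C.lincomb_def module_vec_simps)
    next
      case (insert i J)
      have "b i \<notin> b ` J" using insert inj by (auto dest: inj_onD)
      then have "C.lincomb a (b ` J \<union> {b i}) = a (b i) \<cdot>\<^sub>v b i + C.lincomb a (b ` J)"
        using C.lincomb_insert[of "b ` J" a "b i"] insert.hyps(1)
        by (auto simp: module_vec_simps class_ring_simps b_def)
      then have "C.lincomb a (b ` insert i J) = a (b i) \<cdot>\<^sub>v b i + C.lincomb a (b ` J)"
        by simp
      also have "a (b i) \<cdot>\<^sub>v b i = w (monom (a (b i)) i)"
        by (simp add: b_def smult[symmetric] smult_monom)
      finally show ?case using insert by (simp add: add)
    qed
  qed
  have sub: "b ` ?I \<subseteq> carrier (code_space N (range w))"
    by (auto simp: b_def)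
  have "C.lin_indpt (b ` ?I)"
  proof (rule C.finite_lin_indpt2[OF _ sub])
    fix a assume "C.lincomb a (b ` ?I) = \<zero>\<^bsub>code_space N (range w)\<^esub>"
    then have "w (\<Sum>i\<in>?I. monom (a (b i)) i) = 0\<^sub>v N"
      by (simp add: lincomb module_vec_simps)
    then have "(\<Sum>i\<in>?I. monom (a (b i)) i) = 0"
      by (rule low) (simp add: coeffs)
    then have "a (b i) = 0" if "i < degree p" for i
      using coeffs[of "\<lambda>i. a (b i)" i] that by simp
    then show "\<forall>v\<in>b ` ?I. a v = \<zero>\<^bsub>class_ring\<^esub>" by (auto simp: class_ring_simps)
  qed simp
  moreover have "C.span (b ` ?I) = range w"
  proof
    show "C.span (b ` ?I) \<subseteq> range w"
      using C.span_is_subset2[OF sub] by simp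
    show "range w \<subseteq> C.span (b ` ?I)"
    proof clarify
      fix f
      \<comment> \<open>Linear combinations of sets carry coefficients indexed by vectors, so the coefficients
          of the remainder are transported along the bijection \<open>b\<close>.\<close>
      define a where "a v = coeff (f mod p) (the_inv_into ?I b v)" for v
      have "coeff (f mod p) j = 0" if "j \<ge> degree p" for j
        using degree_mod_less[OF \<open>p \<noteq> 0\<close>, of f] that by (auto intro: coeff_eq_0)
      then have rem: "(\<Sum>i\<in>?I. monom (a (b i)) i) = f mod p"
        by (intro poly_eqI) (auto simp: coeffs a_def the_inv_into_f_f[OF inj])
      have "w (f div p * p) = 0\<^sub>v N" using ker by simp
      then have "w f = w (f mod p)"
        using add[of "f div p * p" "f mod p"] carr by simp
      then have "w f = C.lincomb a (b ` ?I)" by (simp add: lincomb rem)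
      then show "w f \<in> C.span (b ` ?I)"
        unfolding C.finite_span[OF finite_imageI[OF finite_lessThan] sub]
        by (auto simp: class_ring_simps)
    qed
  qed
  ultimately have basis: "C.basis (b ` ?I)"
    using sub by (auto simp: C.basis_def)
  show "inj_on (\<lambda>i. w (monom 1 i)) ?I" using inj by (simp add: b_def)
  show "C.basis ((\<lambda>i. w (monom 1 i)) ` ?I)" using basis by (simp add: b_def)
  show "code_dim N (range w) = degree p"
    using C.dim_basis[OF _ basis] card_image[OF inj] by (simp add: code_dim_def)
qed

section \<open>The quasi-cyclic code as the image of the encoding map\<close>

definition encode :: "nat \<Rightarrow> 'a::field poly \<Rightarrow> 'a poly \<Rightarrow> 'a poly \<Rightarrow> 'a vec" where
  "encode n g g' f = word_of n ((f * g) mod (monom 1 n - 1), (f * g') mod (monom 1 (n div 2) - 1))"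

lemma qc_code_eq_range_encode: "qc_code n g g' = range (encode n g g')"
  by (auto simp: encode_def qc_code_def qc_pairs_def)

lemma encode_add: "encode n g g' (f + h) = encode n g g' f + encode n g g' h"
  by (simp add: encode_def word_of_add poly_mod_add_left distrib_right)

lemma encode_smult: "encode n g g' (smult c f) = c \<cdot>\<^sub>v encode n g g' f"
  by (simp add: encode_def word_of_smult mod_smult_left)

lemma vec_coeff_eq_0_iff:
  assumes "n > 0" and "degree p < n"
  shows "vec n (coeff p) = 0\<^sub>v n \<longleftrightarrow> p = 0"
proof
  assume "vec n (coeff p) = 0\<^sub>v n"
  then have "coeff p (degree p) = 0" using assms(2) by (metis index_vec index_zero_vec(1))
  then show "p = 0" by simp
qed auto

text \<open>
  Remainders modulo \<open>X^n - 1\<close> have degree less than \<open>n\<close>, so truncating to words loses nothing.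
\<close>

lemma encode_eq_0_iff:
  fixes g g' :: "'a::field poly"
  assumes "n div 2 > 0"
  shows "encode n g g' f = 0\<^sub>v (n + n div 2) \<longleftrightarrow>
    monom 1 n - 1 dvd f * g \<and> monom 1 (n div 2) - 1 dvd f * g'"
proof -
  have deg: "degree (h mod (monom 1 k - 1)) < k" if "k > 0" for h :: "'a poly" and k
    using degree_mod_less[of "monom 1 k - 1" h] degree_monom_diff_1[OF that, where 'a='a] that
    by force
  have z: "0\<^sub>v (n + n div 2) = 0\<^sub>v n @\<^sub>v (0\<^sub>v (n div 2) :: 'a vec)" by auto
  have "n > 0" using assms by simp
  have "vec n c @\<^sub>v v = 0\<^sub>v n @\<^sub>v u \<longleftrightarrow> vec n c = 0\<^sub>v n \<and> v = u" for c and u v :: "'a vec"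
    by (rule append_vec_eq[of _ n]) auto
  then show ?thesis
    unfolding z encode_def word_of_def
    using vec_coeff_eq_0_iff[OF \<open>n > 0\<close> deg[OF \<open>n > 0\<close>]] vec_coeff_eq_0_iff[OF assms deg[OF assms]]
    by (simp add: mod_eq_0_iff_dvd)
qed

text \<open>
  Both blocks have \<open>n\<close> rows, so in the right block of width \<open>n div 2\<close> the shift by \<open>i\<close> can
  exceed the width; this is why \<open>coeff_shift_mod_cyclic\<close> has no bound on \<open>i\<close>.
\<close>

lemma row_double_circulant_eq_encode:
  fixes g g' :: "'a::field poly"
  assumes "n div 2 > 0" and "degree g < n" and "degree g' < n div 2" and "i < n"
  shows "row (double_circulant n n (n div 2) g g') i = encode n g g' (monom 1 i)"
proof (rule eq_vecI)
  fix j assume "j < dim_vec (encode n g g' (monom 1 i))"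
  then have j: "j < n + n div 2" by (simp add: encode_def word_of_def)
  have "n > 0" using assms(1) by simp
  show "row (double_circulant n n (n div 2) g g') i $ j = encode n g g' (monom 1 i) $ j"
    using j assms
      coeff_shift_mod_cyclic[OF \<open>n > 0\<close> assms(2), of j i]
      coeff_shift_mod_cyclic[OF assms(1,3), of "j - n" i]
    by (simp add: encode_def word_of_def double_circulant_def gen_circulant_def)
qed (simp add: encode_def word_of_def double_circulant_def)

theorem theorem4p1:
  fixes g g' :: "'a::{finite, field_gcd} poly" and n :: nat
  assumes "even n" and "n > 0"
    and "coprime CHAR('a) n"
    and "degree g < n" and "degree g' < n div 2"
  defines "r \<equiv> n - degree (gcd g (monom 1 (n div 2) + 1)
                          * gcd (gcd g g') (monom 1 (n div 2) - 1))"
  shows "code_dim (n + n div 2) (qc_code n g g') = r \<and>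
         is_generator_matrix (n + n div 2)
           (first_rows r (double_circulant n n (n div 2) g g')) (qc_code n g g')"
proof -
  define m where "m = n div 2"
  have m: "m > 0" "n = m + m" using assms(1,2) by (auto simp: m_def elim: evenE)
  define t s :: "'a poly" where "t = monom 1 m - 1" and "s = monom 1 m + 1"
  define d e where "d = gcd g s" and "e = gcd (gcd g g') t"
  define h where "h = (s div d) * (t div e)"
  have ts: "t * s = monom 1 n - 1"
    by (simp add: t_def s_def m(2) algebra_simps mult_monom)
  have deg_t: "degree t = m" and deg_s: "degree s = m"
    using degree_monom_diff_1[OF m(1), where 'a='a] m(1) degree_add_eq_left[of "1 :: 'a poly" "monom 1 m"]
    by (simp_all add: t_def s_def degree_monom_eq)
  then have nz: "t \<noteq> 0" "s \<noteq> 0" using m(1) by auto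
  have "\<not> CHAR('a) dvd 2"
  proof
    assume "CHAR('a) dvd 2"
    then have "CHAR('a) dvd n" using assms(1) by (rule dvd_trans)
    then have "CHAR('a) = 1" using assms(3) by (metis coprime_absorb_left nat_dvd_1_iff_1)
    then show False by simp
  qed
  then have two: "(2 :: 'a) \<noteq> 0" using of_nat_eq_0_iff_char_dvd[of 2, where 'a='a] by simp
  \<comment> \<open>Any common divisor of \<open>s\<close> and \<open>t\<close> divides their difference, the nonzero constant 2.\<close>
  have cop: "coprime t s"
  proof (rule coprimeI)
    fix c assume "c dvd t" "c dvd s"
    then have "c dvd s - t" by (rule dvd_diff[rotated])
    also have "s - t = [:2:]" by (simp add: s_def t_def numeral_poly)
    also have "[:2:] dvd (1 :: 'a poly)" using two by (simp add: is_unit_pCons_iff)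
    finally show "is_unit c" .
  qed
  have ker: "encode n g g' f = 0\<^sub>v (n + n div 2) \<longleftrightarrow> h dvd f" for f
    using encode_eq_0_iff[of n g g' f] dvd_mult_mult_iff_cofactor_dvd[OF cop nz, of f g g'] m(1)
    by (simp add: ts h_def d_def e_def flip: m_def t_def)
  have sd: "s = (s div d) * d" and te: "t = (t div e) * e"
    by (simp_all add: d_def e_def)
  have split: "t * s = h * (d * e)"
    by (subst sd, subst te) (simp add: h_def ac_simps)
  then have h0: "h \<noteq> 0" and de0: "d * e \<noteq> 0" using nz by auto
  have "n = degree (t * s)" using nz deg_t deg_s m(2) by (simp add: degree_mult_eq)
  also have "\<dots> = degree h + degree (d * e)"
    unfolding split using h0 de0 by (rule degree_mult_eq)
  finally have n: "n = degree h + degree (d * e)" .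
  have r: "r = degree h" using n by (simp add: r_def d_def e_def s_def t_def m_def)
  then have "r \<le> n" by (simp add: r_def)
  note sub = qc_code_subspace[of n g g', unfolded qc_code_eq_range_encode]
  note basis = monomial_images_basis[OF sub encode_add encode_smult ker h0, folded r]
  have rows: "rows (first_rows r (double_circulant n n (n div 2) g g')) =
      map (\<lambda>i. encode n g g' (monom 1 i)) [0..<r]"
  proof -
    have dim: "dim_row (double_circulant n n (n div 2) g g') = n"
      by (simp add: double_circulant_def)
    have "take r (rows (double_circulant n n (n div 2) g g')) =
        map (\<lambda>i. encode n g g' (monom 1 i)) [0..<r]"
      using \<open>r \<le> n\<close> m(1) row_double_circulant_eq_encode[OF _ assms(4,5)]
      by (auto simp: rows_def dim take_map m_def)
    moreover have "set (take r (rows (double_circulant n n (n div 2) g g')))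
        \<subseteq> carrier_vec (dim_col (double_circulant n n (n div 2) g g'))"
      using set_take_subset rows_carrier by fast
    ultimately show ?thesis by (simp add: first_rows_def rows_mat_of_rows)
  qed
  have "distinct (map (\<lambda>i. encode n g g' (monom 1 i)) [0..<r])"
    using basis(1) by (simp add: distinct_map lessThan_atLeast0)
  then show ?thesis
    using basis(2,3)
    unfolding is_generator_matrix_def rows qc_code_eq_range_encode
    by (simp add: lessThan_atLeast0 first_rows_def double_circulant_def)
qed

end
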